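(* There exists an absolute constant $c>0$ such that for every $n\ge 1$ and every function $f\colon \mathbb F_2^n\to\{+1,-1\}$ it holds that $$D^{\rightarrow,U}_{c/n}(f^+)\;\ge\; D^{lin,U}_{1/3}(f).$$
   Context: Boolean values are written as $\pm1$ (bit $0\mapsto +1$, bit $1\mapsto -1$). For $f\colon\mathbb F_2^n\to\{+1,-1\}$ its XOR-function is $f^+\colon\mathbb F_2^n\times\mathbb F_2^n\to\{+1,-1\}$, $f^+(x,y)=f(x+y)$ (addition over $\mathbb F_2$). $U$ denotes the uniform distribution. $D^{lin,U}_\delta(f)$ is the smallest integer $k\ge 0$ such that there exist fixed vectors $\alpha_1,\dots,\alpha_k\in\mathbb F_2^n$ and a function $g\colon\mathbb F_2^k\to\{+1,-1\}$ with $\Pr_{x\sim U(\mathbb F_2^n)}[g(\alpha_1\cdot x,\dots,\alpha_k\cdot x)=f(x)]\ge 1-\delta$, where $\alpha\cdot x=\sum_i\alpha_ix_i$ over $\mathbb F_2$. For $F\colon\mathbb F_2^n\times\mathbb F_2^n\to\{+1,-1\}$, $D^{\rightarrow,U}_\delta(F)$ (one-way distributional communication complexity under the uniform distribution) is the smallest integer $t\ge0$ such that there exist a message function $M\colon\mathbb F_2^n\to\{0,1\}^t$ (Alice's message) and an output function $h\colon\{0,1\}^t\times\mathbb F_2^n\to\{+1,-1\}$ (Bob's output) with $\Pr_{x,y}[h(M(x),y)=F(x,y)]\ge 1-\delta$, where $x,y$ are independent and uniform over $\mathbb F_2^n$. *)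

theory Defs
  imports
    "HOL-Probability.Probability_Mass_Function"
    "HOL-Library.Z2"
    "Jordan_Normal_Form.Matrix"
begin

type_synonym bvec = "bit Matrix.vec"

abbreviation F2 :: "nat \<Rightarrow> bvec set" where
  "F2 n \<equiv> carrier_vec n"

text \<open>Functions on \<open>F2 n\<close> are total functions on \<^typ>\<open>bvec\<close>; only their values on
  \<open>F2 n\<close> matter below.\<close>

definition xor_fun :: "(bvec \<Rightarrow> real) \<Rightarrow> bvec \<times> bvec \<Rightarrow> real" where
  "xor_fun f = (\<lambda>(x, y). f (x + y))"

definition lin_approx :: "nat \<Rightarrow> real \<Rightarrow> (bvec \<Rightarrow> real) \<Rightarrow> nat \<Rightarrow> bool" where
  "lin_approx n \<delta> f k \<longleftrightarrow>
     (\<exists>\<alpha> g. \<alpha> \<in> {..<k} \<rightarrow> F2 n \<and> g \<in> F2 k \<rightarrow> {1, -1} \<and>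
        measure_pmf.prob (pmf_of_set (F2 n))
          {x. g (Matrix.vec k (\<lambda>i. scalar_prod (\<alpha> i) x)) = f x} \<ge> 1 - \<delta>)"

definition D_lin :: "nat \<Rightarrow> real \<Rightarrow> (bvec \<Rightarrow> real) \<Rightarrow> nat" where
  "D_lin n \<delta> f = (LEAST k. lin_approx n \<delta> f k)"

definition oneway_protocol :: "nat \<Rightarrow> real \<Rightarrow> (bvec \<times> bvec \<Rightarrow> real) \<Rightarrow> nat \<Rightarrow> bool" where
  "oneway_protocol n \<delta> F t \<longleftrightarrow>
     (\<exists>M h. M \<in> F2 n \<rightarrow> {m :: bool list. length m = t} \<and>
        h \<in> {m :: bool list. length m = t} \<times> F2 n \<rightarrow> {1, -1} \<and>
        measure_pmf.prob (pair_pmf (pmf_of_set (F2 n)) (pmf_of_set (F2 n)))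
          {(x, y). h (M x, y) = F (x, y)} \<ge> 1 - \<delta>)"

definition D_oneway :: "nat \<Rightarrow> real \<Rightarrow> (bvec \<times> bvec \<Rightarrow> real) \<Rightarrow> nat" where
  "D_oneway n \<delta> F = (LEAST t. oneway_protocol n \<delta> F t)"

text \<open>\<^const>\<open>pmf_of_set\<close> is the uniform distribution only on finite nonempty sets, and
  \<^const>\<open>Least\<close> is a minimum only if a witness exists; the remaining facts ensure both.\<close>

lemma F2_eq_image: "F2 n = vec_of_list ` {xs. length xs = n}"
proof (intro equalityI subsetI)
  fix x :: bvec assume "x \<in> F2 n"
  then have "x = vec_of_list (list_of_vec x)" "length (list_of_vec x) = n"
    by (auto simp: vec_list)
  then show "x \<in> vec_of_list ` {xs. length xs = n}" by blast
qed (auto intro!: carrier_vecI)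

lemma UNIV_bit: "(UNIV :: bit set) = {0, 1}"
  by (metis (full_types) UNIV_eq_I bit.exhaust insertCI)

lemma finite_F2 [simp]: "finite (F2 n)"
proof -
  have "finite (UNIV :: bit set)" by (simp add: UNIV_bit)
  from finite_lists_length_eq[OF this, of n] show ?thesis
    by (simp add: F2_eq_image)
qed

lemma F2_nonempty [simp]: "F2 n \<noteq> {}"
  using zero_carrier_vec by blast

lemma lin_approx_dim:
  assumes "f \<in> F2 n \<rightarrow> {1, -1}" "\<delta> \<ge> 0"
  shows "lin_approx n \<delta> f n"
proof -
  have eq: "Matrix.vec n (\<lambda>i. scalar_prod (unit_vec n i) x) = x" if "x \<in> F2 n" for x :: bvec
    using that by (intro eq_vecI) auto
  have "measure_pmf.prob (pmf_of_set (F2 n))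
      {x. f (Matrix.vec n (\<lambda>i. scalar_prod (unit_vec n i) x)) = f x} = 1"
    by (rule measure_pmf.prob_eq_1[THEN iffD2])
       (auto simp: AE_measure_pmf_iff eq)
  then show ?thesis unfolding lin_approx_def using assms
    by (intro exI[of _ "unit_vec n"] exI[of _ f]) auto
qed

lemma oneway_protocol_dim:
  assumes "F \<in> F2 n \<times> F2 n \<rightarrow> {1, -1}" "\<delta> \<ge> 0"
  shows "oneway_protocol n \<delta> F n"
proof -
  define M where "M = (\<lambda>x :: bvec. map (\<lambda>b. b = 1) (list_of_vec x))"
  define N where "N = (\<lambda>m :: bool list. vec_of_list (map (of_bool :: bool \<Rightarrow> bit) m))"
  have [simp]: "of_bool (b = 1) = b" for b :: bit by (cases b) auto
  have NM: "N (M x) = x" for x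
    by (intro eq_vecI) (auto simp: M_def N_def vec_list)
  have N: "N m \<in> F2 n" if "length m = n" for m
    using that by (auto simp: N_def intro!: carrier_vecI)
  define h where "h = (\<lambda>(m, y). F (N m, y))"
  have "measure_pmf.prob (pair_pmf (pmf_of_set (F2 n)) (pmf_of_set (F2 n)))
      {(x, y). h (M x, y) = F (x, y)} = 1"
    by (rule measure_pmf.prob_eq_1[THEN iffD2])
       (auto simp: AE_measure_pmf_iff h_def NM)
  then show ?thesis unfolding oneway_protocol_def using assms N
    by (intro exI[of _ M] exI[of _ h]) (auto simp: h_def M_def Pi_iff)
qed

lemma xor_fun_Pi: "f \<in> F2 n \<rightarrow> {1, -1} \<Longrightarrow> xor_fun f \<in> F2 n \<times> F2 n \<rightarrow> {1, -1}"
  by (auto simp: xor_fun_def Pi_iff)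

end

theory Submission
  imports Defs
begin

text \<open>
  Let \<open>t\<close> be less than the linear sketch size of \<open>f\<close> and write \<open>N = 2 ^ n\<close>. A message sent on
  a set \<open>S\<close> lets Bob correlate with \<open>f\<close> by \<open>\<Sum>y. \<bar>\<Sum>x\<in>S. f (x + y)\<bar>\<close>, whose quadratic
  analogue is, by Parseval, the Fourier weight of \<open>f\<close> damped by the squared biases of the
  characters on \<open>S\<close>. If \<open>card S \<ge> 3/4 * N / 2 ^ t\<close>, then at most \<open>t\<close> independent characters have
  bias at least \<open>1 - 1/(2 * n)\<close>: by the union bound, \<open>t + 1\<close> of them would confine three quarters
  of \<open>S\<close> to an affine subspace of size \<open>N / 2 ^ (t + 1)\<close>. The span of the strongly biased
  characters carries at most a third of the Fourier weight, since otherwise rounding the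
  conditional expectation of \<open>f\<close> would be a linear sketch with \<open>t\<close> forms. So two thirds of the
  weight is damped by a factor \<open>1 - \<Omega>(1/n)\<close>. Messages sent on smaller sets have total
  probability at most \<open>3/4\<close>, hence every \<open>t\<close>-bit protocol errs with probability \<open>\<Omega>(1/n)\<close>.
\<close>

section \<open>Characters of the Boolean cube\<close>

definition chi :: "bvec \<Rightarrow> bvec \<Rightarrow> real" where
  "chi a x = (if scalar_prod a x = 0 then 1 else -1)"

lemma chi_cases: "chi a x = 1 \<or> chi a x = -1"
  by (simp add: chi_def)

lemma abs_chi [simp]: "\<bar>chi a x\<bar> = 1"
  by (simp add: chi_def)

lemma chi_mult_self [simp]: "chi a x * chi a x = 1"
  by (simp add: chi_def)

lemma bit_add_eq_0_iff: "a + b = 0 \<longleftrightarrow> a = b" for a b :: bit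
  by (cases a; cases b) auto

lemma chi_add_right:
  assumes "a \<in> F2 n" "x \<in> F2 n" "y \<in> F2 n"
  shows "chi a (x + y) = chi a x * chi a y"
  using scalar_prod_add_distrib[OF assms]
  by (auto simp: chi_def bit_add_eq_0_iff)

lemma chi_commute:
  assumes "a \<in> F2 n" "x \<in> F2 n"
  shows "chi a x = chi x a"
  using comm_scalar_prod[OF assms] by (simp add: chi_def)

lemma chi_add_left:
  assumes "a \<in> F2 n" "b \<in> F2 n" "x \<in> F2 n"
  shows "chi (a + b) x = chi a x * chi b x"
  using assms chi_add_right[of x n a b] by (simp add: chi_commute[of _ n x])

lemma F2_add_cancel:
  assumes "x \<in> F2 n" "y \<in> F2 n"
  shows "x + y + y = x"
  using assms by (intro eq_vecI) (auto simp: add.assoc)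

lemma F2_add_eq_0_iff:
  assumes "x \<in> F2 n" "y \<in> F2 n"
  shows "x + y = 0\<^sub>v n \<longleftrightarrow> x = y"
proof
  assume "x + y = 0\<^sub>v n"
  then show "x = y" using F2_add_cancel[OF assms] assms by simp
next
  assume "x = y"
  then show "x + y = 0\<^sub>v n" using assms by (intro eq_vecI) auto
qed

lemma bij_betw_F2_add:
  assumes "y \<in> F2 n"
  shows "bij_betw (\<lambda>x. x + y) (F2 n) (F2 n)"
  by (rule bij_betwI[where g = "\<lambda>x. x + y"]) (use assms in \<open>auto simp: F2_add_cancel\<close>)

lemma sum_F2_shift:
  assumes "y \<in> F2 n"
  shows "(\<Sum>x\<in>F2 n. g (x + y)) = (\<Sum>x\<in>F2 n. g x)"
  by (rule sum.reindex_bij_betw[OF bij_betw_F2_add[OF assms]])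

lemma exists_chi_neg:
  assumes "a \<in> F2 n" "a \<noteq> 0\<^sub>v n"
  shows "\<exists>x\<in>F2 n. chi a x = -1"
proof -
  obtain i where i: "i < n" "vec_index a i \<noteq> 0"
    using assms by (metis carrier_vecD eq_vecI index_zero_vec)
  then have "scalar_prod a (unit_vec n i) \<noteq> 0" using assms by simp
  then show ?thesis by (intro bexI[of _ "unit_vec n i"]) (auto simp: chi_def)
qed

text \<open>Translating by a point where the character is -1 permutes the cube and negates the
  sum.\<close>

lemma sum_chi:
  assumes "a \<in> F2 n"
  shows "(\<Sum>x\<in>F2 n. chi a x) = (if a = 0\<^sub>v n then real (card (F2 n)) else 0)"
proof (cases "a = 0\<^sub>v n")
  case True
  then have "chi a x = 1" if "x \<in> F2 n" for x using that by (simp add: chi_def)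
  then show ?thesis using True by simp
next
  case False
  then obtain y where y: "y \<in> F2 n" "chi a y = -1" using exists_chi_neg assms by blast
  have "(\<Sum>x\<in>F2 n. chi a x) = (\<Sum>x\<in>F2 n. chi a (x + y))"
    using sum_F2_shift[OF y(1)] by metis
  also have "\<dots> = - (\<Sum>x\<in>F2 n. chi a x)"
    using y assms by (simp add: chi_add_right[of a n] sum_negf)
  finally show ?thesis using False by simp
qed

section \<open>Orthogonality, Parseval and the convolution rule\<close>

lemma chi_orthogonal:
  assumes "a \<in> F2 n" "b \<in> F2 n"
  shows "(\<Sum>x\<in>F2 n. chi a x * chi b x) = (if a = b then real (card (F2 n)) else 0)"
proof -
  have "(\<Sum>x\<in>F2 n. chi a x * chi b x) = (\<Sum>x\<in>F2 n. chi (a + b) x)"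
    by (rule sum.cong) (use assms in \<open>auto simp: chi_add_left\<close>)
  also have "\<dots> = (if a = b then real (card (F2 n)) else 0)"
    using assms by (simp add: sum_chi F2_add_eq_0_iff)
  finally show ?thesis .
qed

text \<open>Orthogonality kills the off-diagonal terms of the expanded square. Taking all of
  \<open>F2 n\<close> for \<open>A\<close> gives Parseval; taking a span gives the norm of a
  projection.\<close>

lemma sum_square_chi_expansion:
  assumes "A \<subseteq> F2 n"
  shows "(\<Sum>x\<in>F2 n. (\<Sum>a\<in>A. c a * chi a x)\<^sup>2) = real (card (F2 n)) * (\<Sum>a\<in>A. (c a)\<^sup>2)"
proof -
  have fin: "finite A" using assms finite_F2 finite_subset by blast
  have "(\<Sum>x\<in>F2 n. (\<Sum>a\<in>A. c a * chi a x)\<^sup>2)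
      = (\<Sum>x\<in>F2 n. \<Sum>a\<in>A. \<Sum>b\<in>A. c a * c b * (chi a x * chi b x))"
    by (simp add: power2_eq_square sum_product algebra_simps)
  also have "\<dots> = (\<Sum>a\<in>A. \<Sum>b\<in>A. \<Sum>x\<in>F2 n. c a * c b * (chi a x * chi b x))"
    by (subst sum.swap, rule sum.cong[OF refl], subst sum.swap, rule refl)
  also have "\<dots> = (\<Sum>a\<in>A. \<Sum>b\<in>A. c a * c b * (\<Sum>x\<in>F2 n. chi a x * chi b x))"
    by (simp add: sum_distrib_left)
  also have "\<dots> = (\<Sum>a\<in>A. \<Sum>b\<in>A. if a = b then c a * c b * real (card (F2 n)) else 0)"
    using assms by (intro sum.cong refl) (auto simp: chi_orthogonal subset_iff)
  also have "\<dots> = real (card (F2 n)) * (\<Sum>a\<in>A. (c a)\<^sup>2)"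
    using fin by (simp add: sum_distrib_left power2_eq_square algebra_simps)
  finally show ?thesis .
qed

text \<open>Unnormalised: a sum instead of an average. Hence a sign function on a cube of size N has
  total squared weight N^2.\<close>

definition fourier :: "nat \<Rightarrow> (bvec \<Rightarrow> real) \<Rightarrow> bvec \<Rightarrow> real" where
  "fourier n f a = (\<Sum>x\<in>F2 n. f x * chi a x)"

text \<open>By the symmetry of \<open>chi\<close>, the transform is itself a character expansion,
  with the points x as frequencies and the values f x as coefficients.\<close>

lemma parseval:
  "(\<Sum>a\<in>F2 n. (fourier n f a)\<^sup>2) = real (card (F2 n)) * (\<Sum>x\<in>F2 n. (f x)\<^sup>2)"
proof -
  have "(\<Sum>a\<in>F2 n. (fourier n f a)\<^sup>2) = (\<Sum>a\<in>F2 n. (\<Sum>x\<in>F2 n. f x * chi x a)\<^sup>2)"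
    unfolding fourier_def
    by (intro sum.cong refl arg_cong[where f = "\<lambda>z. z\<^sup>2"]) (simp add: chi_commute)
  then show ?thesis by (simp add: sum_square_chi_expansion)
qed

text \<open>The function of y is the convolution of f with the indicator of \<open>S\<close>, so its
  transform is the product of the two transforms.\<close>

lemma fourier_shift_sum:
  assumes "S \<subseteq> F2 n" "a \<in> F2 n"
  shows "fourier n (\<lambda>y. \<Sum>x\<in>S. f (x + y)) a = (\<Sum>x\<in>S. chi a x) * fourier n f a"
proof -
  have "(\<Sum>y\<in>F2 n. f (x + y) * chi a y) = chi a x * fourier n f a" if x: "x \<in> S" for x
  proof -
    have xF: "x \<in> F2 n" using x assms by blast
    have "(\<Sum>y\<in>F2 n. f (x + y) * chi a y) = (\<Sum>y\<in>F2 n. f (y + x) * chi a (y + x + x))"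
      by (rule sum.cong[OF refl]) (use xF in \<open>metis F2_add_cancel comm_add_vec\<close>)
    also have "\<dots> = (\<Sum>y\<in>F2 n. f y * chi a (y + x))"
      by (rule sum_F2_shift[OF xF])
    also have "\<dots> = chi a x * fourier n f a"
      unfolding fourier_def sum_distrib_left
      by (rule sum.cong) (use xF assms in \<open>auto simp: chi_add_right[of a n]\<close>)
    finally show ?thesis .
  qed
  then show ?thesis
    unfolding fourier_def[of n "\<lambda>y. \<Sum>x\<in>S. f (x + y)"] sum_distrib_right
    by (subst sum.swap) simp
qed

section \<open>Averaging over fibres\<close>

text \<open>The conditional expectation of f given \<phi> under the uniform distribution on
  \<open>X\<close>. If no point of \<open>X\<close> has the value \<phi> x, division by zero makes
  it 0.\<close>

definition fibre_avg :: "'a set \<Rightarrow> ('a \<Rightarrow> 'b) \<Rightarrow> ('a \<Rightarrow> real) \<Rightarrow> 'a \<Rightarrow> real" where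
  "fibre_avg X \<phi> f x = (\<Sum>z | z \<in> X \<and> \<phi> z = \<phi> x. f z) / real (card {z \<in> X. \<phi> z = \<phi> x})"

lemma fibre_avg_cong: "\<phi> x = \<phi> z \<Longrightarrow> fibre_avg X \<phi> f x = fibre_avg X \<phi> f z"
  by (simp add: fibre_avg_def)

text \<open>After swapping the sums, f z is collected once from each x in the fibre of z, each time
  with weight q z over the size of that fibre; these weights add up to q z.\<close>

lemma sum_fibre_avg_mult:
  assumes fin: "finite X" and q: "\<And>x z. x \<in> X \<Longrightarrow> z \<in> X \<Longrightarrow> \<phi> x = \<phi> z \<Longrightarrow> q x = q z"
  shows "(\<Sum>x\<in>X. fibre_avg X \<phi> f x * q x) = (\<Sum>x\<in>X. f x * q x)"
proof -
  define K where "K x = {z \<in> X. \<phi> z = \<phi> x}" for x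
  have "(\<Sum>x\<in>X. fibre_avg X \<phi> f x * q x)
      = (\<Sum>x\<in>X. \<Sum>z\<in>X. if \<phi> z = \<phi> x then f z * q x / card (K x) else 0)"
    using fin unfolding fibre_avg_def K_def
    by (intro sum.cong refl)
       (auto simp: sum_divide_distrib sum_distrib_right sum.inter_filter intro!: sum.cong)
  also have "\<dots> = (\<Sum>z\<in>X. \<Sum>x\<in>X. if \<phi> z = \<phi> x then f z * q x / card (K x) else 0)"
    by (rule sum.swap)
  also have "\<dots> = (\<Sum>z\<in>X. f z * q z)"
  proof (rule sum.cong[OF refl])
    fix z assume z: "z \<in> X"
    have "card (K z) > 0" using z fin by (auto simp: K_def card_gt_0_iff)
    have "(\<Sum>x\<in>X. if \<phi> z = \<phi> x then f z * q x / card (K x) else 0)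
        = (\<Sum>x\<in>X. if \<phi> x = \<phi> z then f z * q z / card (K z) else 0)"
      using q[OF _ z] by (intro sum.cong refl) (auto simp: K_def)
    also have "\<dots> = (\<Sum>x\<in>K z. f z * q z / card (K z))"
      unfolding K_def by (rule sum.inter_filter[OF fin, symmetric])
    also have "\<dots> = f z * q z" using \<open>card (K z) > 0\<close> by simp
    finally show "(\<Sum>x\<in>X. if \<phi> z = \<phi> x then f z * q x / card (K x) else 0) = f z * q z" .
  qed
  finally show ?thesis .
qed

lemma abs_fibre_avg_le_1:
  assumes "\<And>x. x \<in> X \<Longrightarrow> \<bar>f x\<bar> \<le> 1"
  shows "\<bar>fibre_avg X \<phi> f x\<bar> \<le> 1"
proof -
  let ?K = "{z \<in> X. \<phi> z = \<phi> x}"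
  have "\<bar>\<Sum>z\<in>?K. f z\<bar> \<le> (\<Sum>z\<in>?K. \<bar>f z\<bar>)" by (rule sum_abs)
  also have "\<dots> \<le> (\<Sum>z\<in>?K. 1)" using assms by (intro sum_mono) auto
  also have "\<dots> = real (card ?K)" by simp
  finally show ?thesis
    unfolding fibre_avg_def by (cases "card ?K = 0") (auto simp: divide_le_eq)
qed

section \<open>Fourier weight on the span of few linear forms\<close>

text \<open>The span is encoded as a double annihilator, so that no linear combinations are needed.\<close>

definition chi_span :: "nat \<Rightarrow> nat \<Rightarrow> (nat \<Rightarrow> bvec) \<Rightarrow> bvec set" where
  "chi_span n d \<alpha> = {a \<in> F2 n. \<forall>x\<in>F2 n. (\<forall>i<d. chi (\<alpha> i) x = 1) \<longrightarrow> chi a x = 1}"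

text \<open>All the forms vanish at x + z, hence so does the form of a. Thus characters in the span
  depend only on the values of the d forms.\<close>

lemma chi_span_cong:
  assumes "\<alpha> \<in> {..<d} \<rightarrow> F2 n" "a \<in> chi_span n d \<alpha>" "x \<in> F2 n" "z \<in> F2 n"
    and eq: "\<And>i. i < d \<Longrightarrow> chi (\<alpha> i) x = chi (\<alpha> i) z"
  shows "chi a x = chi a z"
proof -
  have "chi (\<alpha> i) (x + z) = 1" if "i < d" for i
    using that assms(1,3,4) eq[OF that] chi_add_right[of "\<alpha> i" n x z] by (auto simp: Pi_iff)
  then have "chi a (x + z) = 1" using assms(2-4) by (auto simp: chi_span_def)
  then have "chi a x * chi a z = 1"
    using assms(2-4) chi_add_right[of a n x z] by (auto simp: chi_span_def)
  then show ?thesis using chi_cases[of a x] chi_cases[of a z] by auto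
qed

text \<open>Agreements count +1 and disagreements -1. This converts between correlation and the
  number of agreements for sketches, biases and protocols alike.\<close>

lemma sum_mult_sign_eq_card:
  fixes u v :: "'a \<Rightarrow> real"
  assumes "finite X" "\<And>x. x \<in> X \<Longrightarrow> u x \<in> {1, -1}" "\<And>x. x \<in> X \<Longrightarrow> v x \<in> {1, -1}"
  shows "(\<Sum>x\<in>X. u x * v x) = 2 * real (card {x \<in> X. u x = v x}) - real (card X)"
proof -
  have "(\<Sum>x\<in>X. u x * v x) = (\<Sum>x\<in>X. 2 * (if u x = v x then 1 else 0) - 1)"
    using assms(2,3) by (intro sum.cong refl) fastforce
  also have "\<dots> = 2 * (\<Sum>x\<in>X. if u x = v x then 1 else 0) - real (card X)"
    by (simp add: sum_subtractf sum_distrib_left)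
  also have "(\<Sum>x\<in>X. if u x = v x then 1 else 0) = real (card {x \<in> X. u x = v x})"
    using assms(1) by (simp flip: sum.inter_filter)
  finally show ?thesis .
qed

text \<open>The best predictor from the d forms is the sign \<open>g\<close> of the conditional
  expectation \<open>P\<close>. Its correlation with f is the L1 norm of \<open>P\<close>, which
  dominates the squared L2 norm because \<open>P\<close> is bounded by 1, and the latter dominates
  the Fourier weight on the span.\<close>

lemma fourier_weight_le_correlation:
  assumes f: "f \<in> F2 n \<rightarrow> {1, -1}" and \<alpha>: "\<alpha> \<in> {..<d} \<rightarrow> F2 n"
  obtains g where "g \<in> F2 d \<rightarrow> {1, -1}"
    "(\<Sum>a\<in>chi_span n d \<alpha>. (fourier n f a)\<^sup>2)
      \<le> real (card (F2 n)) * (\<Sum>x\<in>F2 n. g (Matrix.vec d (\<lambda>i. scalar_prod (\<alpha> i) x)) * f x)"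
proof -
  define A where "A = chi_span n d \<alpha>"
  define N where "N = real (card (F2 n))"
  define \<phi> where "\<phi> x = Matrix.vec d (\<lambda>i. scalar_prod (\<alpha> i) x)" for x
  define P where "P = fibre_avg (F2 n) \<phi> f"
  define p where "p x = (\<Sum>a\<in>A. fourier n f a * chi a x)" for x
  define w where "w = (\<Sum>a\<in>A. (fourier n f a)\<^sup>2)"
  \<comment> \<open>The sign of \<open>P\<close> on the fibre over b; the value 1 covers both
    \<open>P\<close> = 0 and vectors b that no x attains.\<close>
  define g where "g b = (if \<exists>x\<in>F2 n. \<phi> x = b \<and> P x < 0 then -1 else 1 :: real)" for b
  have AF: "A \<subseteq> F2 n" by (auto simp: A_def chi_span_def)
  have N: "N > 0" by (simp add: N_def card_gt_0_iff)
  have chi_eq: "chi (\<alpha> i) x = chi (\<alpha> i) z" if "\<phi> x = \<phi> z" "i < d" for x z i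
  proof -
    have "vec_index (\<phi> x) i = vec_index (\<phi> z) i" using that by simp
    then show ?thesis using that(2) by (simp add: \<phi>_def chi_def)
  qed
  have p_cong: "p x = p z" if "x \<in> F2 n" "z \<in> F2 n" "\<phi> x = \<phi> z" for x z
    unfolding p_def using chi_span_cong[OF \<alpha> _ that(1,2) chi_eq[OF that(3)]]
    by (intro sum.cong refl) (simp add: A_def)
  have gP: "P x * g (\<phi> x) = \<bar>P x\<bar>" if "x \<in> F2 n" for x
  proof -
    have "P z = P x" if "\<phi> z = \<phi> x" for z
      using that unfolding P_def by (rule fibre_avg_cong)
    then have "(\<exists>z\<in>F2 n. \<phi> z = \<phi> x \<and> P z < 0) \<longleftrightarrow> P x < 0"
      using that by metis
    then show ?thesis by (simp add: g_def)
  qed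
  have "(\<Sum>x\<in>F2 n. f x * p x) = w"
  proof -
    have "(\<Sum>x\<in>F2 n. f x * p x) = (\<Sum>a\<in>A. \<Sum>x\<in>F2 n. fourier n f a * (f x * chi a x))"
      unfolding p_def sum_distrib_left by (subst sum.swap) (simp add: algebra_simps)
    also have "\<dots> = w"
      by (simp add: w_def power2_eq_square fourier_def flip: sum_distrib_left)
    finally show ?thesis .
  qed
  then have Pp: "(\<Sum>x\<in>F2 n. P x * p x) = w"
    unfolding P_def by (subst sum_fibre_avg_mult[OF finite_F2]) (auto intro: p_cong)
  have pp: "(\<Sum>x\<in>F2 n. (p x)\<^sup>2) = N * w"
    unfolding p_def w_def N_def by (rule sum_square_chi_expansion[OF AF])
  \<comment> \<open>The factor \<open>N\<close> matches the unnormalised \<open>p\<close>: the cross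
    term contributes -2 \<open>N\<close> \<open>w\<close> and the square of \<open>p\<close>
    contributes \<open>N\<close> \<open>w\<close>.\<close>
  have "0 \<le> (\<Sum>x\<in>F2 n. (N * P x - p x)\<^sup>2)" by (simp add: sum_nonneg)
  also have "\<dots> = (\<Sum>x\<in>F2 n. N\<^sup>2 * (P x)\<^sup>2 - 2 * N * (P x * p x) + (p x)\<^sup>2)"
    by (simp add: power2_eq_square algebra_simps)
  also have "\<dots> = N\<^sup>2 * (\<Sum>x\<in>F2 n. (P x)\<^sup>2) - N * w"
    by (simp add: sum.distrib sum_subtractf pp Pp flip: sum_distrib_left)
  finally have "w \<le> N * (\<Sum>x\<in>F2 n. (P x)\<^sup>2)"
    using N by (simp add: power2_eq_square)
  also have "(\<Sum>x\<in>F2 n. (P x)\<^sup>2) \<le> (\<Sum>x\<in>F2 n. \<bar>P x\<bar>)"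
  proof (rule sum_mono)
    fix x
    have "\<bar>f x\<bar> \<le> 1" if "x \<in> F2 n" for x using f that by (force simp: Pi_iff)
    then have "\<bar>P x\<bar> \<le> 1"
      unfolding P_def by (rule abs_fibre_avg_le_1)
    then show "(P x)\<^sup>2 \<le> \<bar>P x\<bar>"
      using mult_left_le[of "\<bar>P x\<bar>" "\<bar>P x\<bar>"] by (simp add: power2_eq_square)
  qed
  also have "(\<Sum>x\<in>F2 n. \<bar>P x\<bar>) = (\<Sum>x\<in>F2 n. P x * g (\<phi> x))"
    by (rule sum.cong) (auto simp: gP)
  also have "\<dots> = (\<Sum>x\<in>F2 n. f x * g (\<phi> x))"
    unfolding P_def by (rule sum_fibre_avg_mult) auto
  finally have "w \<le> N * (\<Sum>x\<in>F2 n. g (\<phi> x) * f x)"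
    using N by (simp add: mult.commute)
  then show ?thesis
    by (intro that[of g]) (auto simp: w_def A_def N_def \<phi>_def g_def)
qed

text \<open>The rounded predictor is a sketch with d forms, so it agrees with f on less than 2/3 of
  the cube and its correlation is below 2/3 - 1/3 = 1/3.\<close>

lemma fourier_weight_le_third:
  assumes f: "f \<in> F2 n \<rightarrow> {1, -1}" and \<alpha>: "\<alpha> \<in> {..<d} \<rightarrow> F2 n"
    and not: "\<not> lin_approx n (1/3) f d"
  shows "(\<Sum>a\<in>chi_span n d \<alpha>. (fourier n f a)\<^sup>2) \<le> (real (card (F2 n)))\<^sup>2 / 3"
proof -
  define N where "N = real (card (F2 n))"
  define \<phi> where "\<phi> x = Matrix.vec d (\<lambda>i. scalar_prod (\<alpha> i) x)" for x
  have N: "N > 0" by (simp add: N_def card_gt_0_iff)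
  obtain g where g: "g \<in> F2 d \<rightarrow> {1, -1}" and
    le: "(\<Sum>a\<in>chi_span n d \<alpha>. (fourier n f a)\<^sup>2) \<le> N * (\<Sum>x\<in>F2 n. g (\<phi> x) * f x)"
    using fourier_weight_le_correlation[OF f \<alpha>] unfolding N_def \<phi>_def by blast
  have "measure_pmf.prob (pmf_of_set (F2 n)) {x. g (\<phi> x) = f x} < 2/3"
    using not \<alpha> g by (auto simp: lin_approx_def \<phi>_def not_le)
  then have "real (card {x \<in> F2 n. g (\<phi> x) = f x}) < 2/3 * N"
    using N by (simp add: measure_pmf_of_set N_def Int_def field_simps)
  moreover have "(\<Sum>x\<in>F2 n. g (\<phi> x) * f x) = 2 * real (card {x \<in> F2 n. g (\<phi> x) = f x}) - N"
    unfolding N_def using g f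
    by (intro sum_mult_sign_eq_card) (auto simp: \<phi>_def Pi_iff)
  ultimately have "(\<Sum>x\<in>F2 n. g (\<phi> x) * f x) \<le> N / 3" by simp
  then have "N * (\<Sum>x\<in>F2 n. g (\<phi> x) * f x) \<le> N * (N / 3)"
    using N by (intro mult_left_mono) auto
  with le show ?thesis by (simp add: N_def power2_eq_square)
qed

section \<open>Strongly biased characters of a large set\<close>

text \<open>Linear independence is encoded through the sizes of the fibres.\<close>

definition small_fibres :: "nat \<Rightarrow> nat \<Rightarrow> (nat \<Rightarrow> bvec) \<Rightarrow> bool" where
  "small_fibres n d \<alpha> \<longleftrightarrow>
     (\<forall>b. card {x \<in> F2 n. \<forall>i<d. chi (\<alpha> i) x = b i} * 2 ^ d \<le> card (F2 n))"

lemma small_fibres_0: "small_fibres n 0 \<alpha>"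
  by (simp add: small_fibres_def)

text \<open>Since v is outside the span, some \<open>u\<close> satisfies all old characters but
  flips v. Translation by \<open>u\<close> injects the part \<open>K1\<close> of an old fibre
  \<open>K\<close> into the rest of \<open>K\<close>, so each new fibre is at most half of an old
  one.\<close>

lemma small_fibres_Suc:
  assumes \<alpha>: "\<alpha> \<in> {..<d} \<rightarrow> F2 n" and sm: "small_fibres n d \<alpha>"
    and v: "v \<in> F2 n" "v \<notin> chi_span n d \<alpha>"
  shows "small_fibres n (Suc d) (\<alpha>(d := v))"
  unfolding small_fibres_def
proof
  fix b
  define K where "K = {x \<in> F2 n. \<forall>i<d. chi (\<alpha> i) x = b i}"
  define K1 where "K1 = {x \<in> K. chi v x = b d}"
  obtain u where u: "u \<in> F2 n" "\<And>i. i < d \<Longrightarrow> chi (\<alpha> i) u = 1" "chi v u \<noteq> 1"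
    using v by (auto simp: chi_span_def)
  have u': "chi v u = -1" using u(3) chi_cases by blast
  have fin: "finite K" by (simp add: K_def)
  have "{x \<in> F2 n. \<forall>i<Suc d. chi ((\<alpha>(d := v)) i) x = b i} = K1"
    by (auto simp: K_def K1_def less_Suc_eq)
  moreover have "2 * card K1 \<le> card K"
  proof -
    have "(\<lambda>x. x + u) ` K1 \<subseteq> K - K1"
    proof
      fix y assume "y \<in> (\<lambda>x. x + u) ` K1"
      then obtain x where x: "x \<in> K1" "y = x + u" by blast
      have xF: "x \<in> F2 n" using x by (simp add: K1_def K_def)
      have "chi (\<alpha> i) y = b i" if "i < d" for i
        using that x u \<alpha> xF chi_add_right[of "\<alpha> i" n x u] by (auto simp: K1_def K_def Pi_iff)
      moreover have "chi v y = - b d"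
        using x u u' v xF chi_add_right[of v n x u] by (auto simp: K1_def)
      \<comment> \<open>The target b ranges over arbitrary reals; excluding 0 separates
        \<open>b d\<close> from its negative.\<close>
      moreover have "b d \<noteq> 0" using x chi_cases[of v x] by (auto simp: K1_def)
      ultimately show "y \<in> K - K1" using x u xF by (auto simp: K1_def K_def)
    qed
    moreover have "inj_on (\<lambda>x. x + u) K1"
      using bij_betw_F2_add[OF u(1)]
      by (rule inj_on_subset[OF bij_betw_imp_inj_on]) (auto simp: K1_def K_def)
    ultimately have "card K1 \<le> card (K - K1)"
      using fin by (metis card_image card_mono finite_Diff)
    moreover have "card (K - K1) + card K1 = card K"
      using fin by (metis (no_types, lifting) K1_def card_Diff_subset card_mono finite_subset
          le_add_diff_inverse2 mem_Collect_eq subsetI)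
    ultimately show ?thesis by simp
  qed
  moreover have "card K * 2 ^ d \<le> card (F2 n)"
    using sm by (simp add: small_fibres_def K_def)
  moreover have "2 * card K1 * 2 ^ d \<le> card K * 2 ^ d"
    using \<open>2 * card K1 \<le> card K\<close> by (rule mult_right_mono) simp
  then have "card K1 * 2 ^ Suc d \<le> card K * 2 ^ d" by (simp add: mult_ac)
  ultimately show "card {x \<in> F2 n. \<forall>i<Suc d. chi ((\<alpha>(d := v)) i) x = b i} * 2 ^ Suc d \<le> card (F2 n)"
    by (metis order_trans)
qed

text \<open>Elements of \<open>B\<close> are picked as long as independence survives. A tuple from
  \<open>B\<close> that cannot be extended within \<open>B\<close> has all of \<open>B\<close> in
  its span.\<close>

lemma chi_span_cover:
  assumes B: "B \<subseteq> F2 n"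
    and bound: "\<And>\<alpha>. \<alpha> \<in> {..<Suc t} \<rightarrow> B \<Longrightarrow> \<not> small_fibres n (Suc t) \<alpha>"
  obtains d \<alpha> where "d \<le> t" "\<alpha> \<in> {..<d} \<rightarrow> F2 n" "B \<subseteq> chi_span n d \<alpha>"
proof -
  define Q where "Q d \<longleftrightarrow> (\<exists>\<alpha>. \<alpha> \<in> {..<d} \<rightarrow> B \<and> small_fibres n d \<alpha>)" for d
  have "Q 0" by (auto simp: Q_def small_fibres_0)
  have "\<not> Q (Suc t)" using bound by (auto simp: Q_def)
  \<comment> \<open>The property \<open>Q\<close> holds at 0 and fails at \<open>Suc t\<close>, so
    it is lost at some step between d and \<open>Suc d\<close> with d at most t.\<close>
  then obtain d where d: "d \<le> t" "Q d" "\<not> Q (Suc d)"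
    using \<open>Q 0\<close> by (metis (no_types, lifting) dec_induct le0 less_Suc_eq_le)
  then obtain \<alpha> where \<alpha>: "\<alpha> \<in> {..<d} \<rightarrow> B" "small_fibres n d \<alpha>" by (auto simp: Q_def)
  have \<alpha>F: "\<alpha> \<in> {..<d} \<rightarrow> F2 n" using \<alpha> B by auto
  have "v \<in> chi_span n d \<alpha>" if v: "v \<in> B" for v
  proof (rule ccontr)
    assume "v \<notin> chi_span n d \<alpha>"
    then have "small_fibres n (Suc d) (\<alpha>(d := v))"
      using small_fibres_Suc[OF \<alpha>F \<alpha>(2)] v B by blast
    moreover have "\<alpha>(d := v) \<in> {..<Suc d} \<rightarrow> B"
      using \<alpha> v by (auto simp: less_Suc_eq Pi_iff)
    ultimately show False using d(3) by (auto simp: Q_def)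
  qed
  then show ?thesis using that d(1) \<alpha>F by blast
qed

text \<open>The absolute character sum is the size of the majority minus that of the minority, so a
  relative bias of 1 - 2\<eta> leaves the minority a fraction of at most \<eta>.\<close>

lemma card_minority_le:
  assumes "finite S" and "\<bar>\<Sum>x\<in>S. chi a x\<bar> \<ge> (1 - 2 * \<eta>) * real (card S)"
  obtains b where "real (card {x \<in> S. chi a x \<noteq> b}) \<le> \<eta> * real (card S)"
proof -
  define b :: real where "b = (if (\<Sum>x\<in>S. chi a x) \<ge> 0 then 1 else -1)"
  have "\<bar>\<Sum>x\<in>S. chi a x\<bar> = (\<Sum>x\<in>S. chi a x * b)"
    by (auto simp: b_def sum_negf)
  also have "\<dots> = 2 * real (card {x \<in> S. chi a x = b}) - real (card S)"
    using assms(1) chi_cases by (intro sum_mult_sign_eq_card) (auto simp: b_def)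
  also have "real (card {x \<in> S. chi a x = b}) = real (card S) - real (card {x \<in> S. chi a x \<noteq> b})"
  proof -
    have "card S = card ({x \<in> S. chi a x = b} \<union> {x \<in> S. chi a x \<noteq> b})"
      by (rule arg_cong[where f = card]) auto
    also have "\<dots> = card {x \<in> S. chi a x = b} + card {x \<in> S. chi a x \<noteq> b}"
      using assms(1) by (intro card_Un_disjoint) auto
    finally show ?thesis by simp
  qed
  finally have "real (card {x \<in> S. chi a x \<noteq> b}) \<le> \<eta> * real (card S)"
    using assms(2) by (simp add: algebra_simps)
  then show ?thesis by (rule that)
qed

lemma biased_not_small_fibres:
  assumes S: "S \<subseteq> F2 n" and t: "t < n"
    and large: "3 * real (card (F2 n)) \<le> 4 * 2 ^ t * real (card S)"
    and \<alpha>: "\<And>i. i < Suc t \<Longrightarrow>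
      \<bar>\<Sum>x\<in>S. chi (\<alpha> i) x\<bar> \<ge> (1 - 2 * (1 / (4 * real n))) * real (card S)"
  shows "\<not> small_fibres n (Suc t) \<alpha>"
proof
  assume sm: "small_fibres n (Suc t) \<alpha>"
  have fin: "finite S" using S finite_F2 finite_subset by blast
  define \<eta> where "\<eta> = 1 / (4 * real n)"
  have N: "real (card (F2 n)) > 0" by (simp add: card_gt_0_iff)
  have "\<exists>b. real (card {x \<in> S. chi (\<alpha> i) x \<noteq> b}) \<le> \<eta> * real (card S)" if "i < Suc t" for i
    using card_minority_le[OF fin \<alpha>[OF that]] unfolding \<eta>_def by blast
  then obtain b where b: "\<And>i. i < Suc t \<Longrightarrow>
      real (card {x \<in> S. chi (\<alpha> i) x \<noteq> b i}) \<le> \<eta> * real (card S)"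
    by metis
  define K where "K = {x \<in> F2 n. \<forall>i<Suc t. chi (\<alpha> i) x = b i}"
  have "S \<subseteq> K \<union> (\<Union>i<Suc t. {x \<in> S. chi (\<alpha> i) x \<noteq> b i})"
    using S by (auto simp: K_def)
  then have "card S \<le> card (K \<union> (\<Union>i<Suc t. {x \<in> S. chi (\<alpha> i) x \<noteq> b i}))"
    using fin by (intro card_mono) (auto simp: K_def)
  also have "\<dots> \<le> card K + card (\<Union>i<Suc t. {x \<in> S. chi (\<alpha> i) x \<noteq> b i})"
    by (rule card_Un_le)
  also have "\<dots> \<le> card K + (\<Sum>i<Suc t. card {x \<in> S. chi (\<alpha> i) x \<noteq> b i})"
    by (intro add_left_mono card_UN_le) simp
  finally have "real (card S) \<le> real (card K + (\<Sum>i<Suc t. card {x \<in> S. chi (\<alpha> i) x \<noteq> b i}))"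
    by (simp only: of_nat_le_iff)
  also have "\<dots> = real (card K) + (\<Sum>i<Suc t. real (card {x \<in> S. chi (\<alpha> i) x \<noteq> b i}))"
    by (simp only: of_nat_add of_nat_sum)
  also have "\<dots> \<le> real (card K) + (\<Sum>i<Suc t. \<eta> * real (card S))"
    using b by (intro add_left_mono sum_mono) auto
  also have "\<dots> = real (card K) + real (Suc t) * \<eta> * real (card S)" by simp
  also have "\<dots> \<le> real (card K) + 1 / 4 * real (card S)"
  proof -
    \<comment> \<open>From t < n there are at most n characters, each losing at most a fraction
      1/(4n) of \<open>S\<close>.\<close>
    have "real (Suc t) * \<eta> \<le> 1 / 4" using t by (simp add: \<eta>_def field_simps)
    then show ?thesis by (intro add_left_mono mult_right_mono) auto
  qed
  finally have "3 * real (card S) \<le> 4 * real (card K)" by simp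
  \<comment> \<open>With N the size of the cube, \<open>K\<close> has at most N / 2^(t+1) points, so
    \<open>S\<close> has at most 2/3 * N / 2^t, against the assumed 3/4 * N / 2^t.\<close>
  then have "2 ^ t * (3 * real (card S)) \<le> 2 ^ t * (4 * real (card K))"
    by (rule mult_left_mono) simp
  moreover have "real (card K * 2 ^ Suc t) \<le> real (card (F2 n))"
    using sm unfolding small_fibres_def K_def of_nat_le_iff by blast
  then have "2 * (2 ^ t * real (card K)) \<le> real (card (F2 n))"
    by (simp add: mult_ac)
  moreover have "3 * real (card (F2 n)) \<le> 4 * (2 ^ t * real (card S))"
    using large by (simp add: mult_ac)
  ultimately show False using N by argo
qed

section \<open>The lower bound\<close>

lemma large_message_correlation:
  assumes f: "f \<in> F2 n \<rightarrow> {1, -1}" and S: "S \<subseteq> F2 n" and t: "t < n"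
    and not: "\<And>d. d \<le> t \<Longrightarrow> \<not> lin_approx n (1/3) f d"
    and large: "3 * real (card (F2 n)) \<le> 4 * 2 ^ t * real (card S)"
  shows "(\<Sum>y\<in>F2 n. \<bar>\<Sum>x\<in>S. f (x + y)\<bar>)
    \<le> real (card (F2 n)) * real (card S) * (1 - 1 / (6 * real n))"
proof -
  define N where "N = real (card (F2 n))"
  define s where "s = real (card S)"
  define \<rho> where "\<rho> = 1 - 2 * (1 / (4 * real n))"
  define m where "m a = (\<Sum>x\<in>S. chi a x)" for a
  define W where "W y = (\<Sum>x\<in>S. f (x + y))" for y
  define B where "B = {a \<in> F2 n. \<bar>m a\<bar> \<ge> \<rho> * s}"
  have N: "N > 0" by (simp add: N_def card_gt_0_iff)
  have s: "s > 0" using large N by (cases "s = 0") (auto simp: s_def N_def)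
  have \<rho>: "0 \<le> \<rho>" "\<rho> \<le> 1" using t by (auto simp: \<rho>_def field_simps)
  obtain d \<alpha> where d: "d \<le> t" "\<alpha> \<in> {..<d} \<rightarrow> F2 n" "B \<subseteq> chi_span n d \<alpha>"
  proof (rule chi_span_cover)
    show "B \<subseteq> F2 n" by (auto simp: B_def)
    show "\<not> small_fibres n (Suc t) \<alpha>" if "\<alpha> \<in> {..<Suc t} \<rightarrow> B" for \<alpha>
      using that by (intro biased_not_small_fibres[OF S t large])
        (auto simp: B_def Pi_iff m_def s_def \<rho>_def)
  qed
  define A where "A = chi_span n d \<alpha>"
  have AF: "A \<subseteq> F2 n" by (auto simp: A_def chi_span_def)
  define w where "w = (\<Sum>a\<in>A. (fourier n f a)\<^sup>2)"
  have w: "w \<le> N\<^sup>2 / 3"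
    unfolding w_def A_def N_def using fourier_weight_le_third[OF f d(2) not[OF d(1)]] .
  have "(f x)\<^sup>2 = 1" if "x \<in> F2 n" for x using f that by (force simp: Pi_iff)
  then have tot: "(\<Sum>a\<in>F2 n. (fourier n f a)\<^sup>2) = N\<^sup>2"
    by (simp add: parseval N_def power2_eq_square[of "real _"])
  have rest: "(\<Sum>a\<in>F2 n - A. (fourier n f a)\<^sup>2) = N\<^sup>2 - w"
    unfolding w_def tot[symmetric] using AF by (intro sum_diff) auto
  have m_le: "\<bar>m a\<bar> \<le> s" for a
    using sum_abs[of "chi a" S] by (simp add: m_def s_def)
  have "N * (\<Sum>y\<in>F2 n. (W y)\<^sup>2) = (\<Sum>a\<in>F2 n. (fourier n W a)\<^sup>2)"
    by (simp add: parseval N_def)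
  also have "\<dots> = (\<Sum>a\<in>F2 n. (m a)\<^sup>2 * (fourier n f a)\<^sup>2)"
    unfolding W_def m_def using fourier_shift_sum[OF S]
    by (intro sum.cong refl) (simp add: power_mult_distrib)
  also have "\<dots> = (\<Sum>a\<in>A. (m a)\<^sup>2 * (fourier n f a)\<^sup>2)
      + (\<Sum>a\<in>F2 n - A. (m a)\<^sup>2 * (fourier n f a)\<^sup>2)"
    using AF by (subst sum.subset_diff[of A]) auto
  \<comment> \<open>On \<open>A\<close> only the trivial bound on the bias is used; off
    \<open>A\<close> the bias is below \<rho>, since \<open>A\<close> contains
    \<open>B\<close>.\<close>
  also have "\<dots> \<le> (\<Sum>a\<in>A. s\<^sup>2 * (fourier n f a)\<^sup>2)
      + (\<Sum>a\<in>F2 n - A. (\<rho> * s)\<^sup>2 * (fourier n f a)\<^sup>2)"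
  proof (intro add_mono sum_mono mult_right_mono)
    show "(m a)\<^sup>2 \<le> s\<^sup>2" for a
      using power_mono[OF m_le[of a], of 2] by simp
    show "(m a)\<^sup>2 \<le> (\<rho> * s)\<^sup>2" if "a \<in> F2 n - A" for a
    proof -
      have "\<bar>m a\<bar> \<le> \<rho> * s" using that d(3) by (auto simp: A_def B_def)
      then show ?thesis using power_mono[of "\<bar>m a\<bar>" "\<rho> * s" 2] by simp
    qed
  qed auto
  also have "\<dots> = s\<^sup>2 * (w + \<rho>\<^sup>2 * (N\<^sup>2 - w))"
    by (simp add: rest w_def power_mult_distrib algebra_simps flip: sum_distrib_left)
  \<comment> \<open>At least 2/3 of the weight lies off \<open>A\<close> and loses a fraction of at
    least 1 - \<rho> = 1/(2n), which gives 1/(3n).\<close>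
  also have "\<dots> \<le> s\<^sup>2 * (N\<^sup>2 * (1 - 1 / (3 * real n)))"
  proof (rule mult_left_mono)
    have "\<rho>\<^sup>2 \<le> \<rho>" using \<rho> by (simp add: power2_eq_square mult_left_le)
    moreover have "N\<^sup>2 - w \<ge> 0" using w zero_le_power2[of N] by linarith
    ultimately have "w + \<rho>\<^sup>2 * (N\<^sup>2 - w) \<le> w + \<rho> * (N\<^sup>2 - w)"
      by (intro add_left_mono mult_right_mono)
    also have "\<dots> = \<rho> * N\<^sup>2 + (1 - \<rho>) * w" by (simp add: algebra_simps)
    also have "\<dots> \<le> \<rho> * N\<^sup>2 + (1 - \<rho>) * (N\<^sup>2 / 3)"
      using \<rho> w by (intro add_left_mono mult_left_mono) auto
    also have "\<dots> = N\<^sup>2 * (1 - 1 / (3 * real n))"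
      using t by (simp add: \<rho>_def field_simps)
    finally show "w + \<rho>\<^sup>2 * (N\<^sup>2 - w) \<le> N\<^sup>2 * (1 - 1 / (3 * real n))" .
  qed simp
  also have "\<dots> = N * (s\<^sup>2 * N * (1 - 1 / (3 * real n)))"
    by (simp add: power2_eq_square)
  finally have WW: "(\<Sum>y\<in>F2 n. (W y)\<^sup>2) \<le> s\<^sup>2 * N * (1 - 1 / (3 * real n))"
    using N by simp
  \<comment> \<open>Passing from the quadratic to the L1 bound by AM-GM with the maximal value
    \<open>s\<close> halves the saving to 1/(6n).\<close>
  have "2 * s * (\<Sum>y\<in>F2 n. \<bar>W y\<bar>) = (\<Sum>y\<in>F2 n. 2 * s * \<bar>W y\<bar>)"
    by (simp add: sum_distrib_left)
  also have "\<dots> \<le> (\<Sum>y\<in>F2 n. s\<^sup>2 + (W y)\<^sup>2)"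
  proof (rule sum_mono)
    fix y
    show "2 * s * \<bar>W y\<bar> \<le> s\<^sup>2 + (W y)\<^sup>2" using sum_squares_bound[of s "\<bar>W y\<bar>"] by simp
  qed
  also have "\<dots> = N * s\<^sup>2 + (\<Sum>y\<in>F2 n. (W y)\<^sup>2)" by (simp add: sum.distrib N_def)
  also have "\<dots> \<le> N * s\<^sup>2 + s\<^sup>2 * N * (1 - 1 / (3 * real n))" using WW by simp
  also have "\<dots> = 2 * s * (N * s * (1 - 1 / (6 * real n)))"
    using t by (simp add: power2_eq_square field_simps)
  finally have "(\<Sum>y\<in>F2 n. \<bar>W y\<bar>) \<le> N * s * (1 - 1 / (6 * real n))"
    using s by simp
  then show ?thesis by (simp add: W_def N_def s_def)
qed

text \<open>The inputs are grouped by message. Given a message, Bob does best by following the sign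
  of the sum of f (x + y) over the x that send it, so absolute values bound his correlation.\<close>

lemma protocol_correlation:
  assumes f: "f \<in> F2 n \<rightarrow> {1, -1}" and t: "t < n"
    and not: "\<And>d. d \<le> t \<Longrightarrow> \<not> lin_approx n (1/3) f d"
    and M: "M \<in> F2 n \<rightarrow> {m :: bool list. length m = t}"
    and h: "h \<in> {m :: bool list. length m = t} \<times> F2 n \<rightarrow> {1, -1}"
  shows "(\<Sum>(x, y)\<in>F2 n \<times> F2 n. h (M x, y) * f (x + y))
    \<le> (real (card (F2 n)))\<^sup>2 * (1 - 1 / (24 * real n))"
proof -
  define N where "N = real (card (F2 n))"
  define L where "L = {m :: bool list. length m = t}"
  define S where "S m = {x \<in> F2 n. M x = m}" for m
  define s where "s m = real (card (S m))" for m
  \<comment> \<open>There are 2^t messages, so those below this threshold cover at most 3/4 of the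
    inputs and \<open>G\<close> keeps at least a quarter. The saving 1/(6n) on that quarter is the
    final 1/(24n).\<close>
  define G where "G = {m \<in> L. 3 * N \<le> 4 * 2 ^ t * s m}"
  have finL: "finite L" using finite_lists_length_eq[of "UNIV :: bool set" t] by (simp add: L_def)
  have cardL: "card L = 2 ^ t"
    using card_lists_length_eq[of "UNIV :: bool set" t] by (simp add: L_def)
  have N: "N > 0" by (simp add: N_def card_gt_0_iff)
  have SF: "S m \<subseteq> F2 n" for m by (auto simp: S_def)
  have group: "(\<Sum>m\<in>L. \<Sum>x\<in>S m. q x) = (\<Sum>x\<in>F2 n. q x)" for q :: "bvec \<Rightarrow> real"
    unfolding S_def using M finL by (intro sum.group) (auto simp: L_def)
  have sum_s: "(\<Sum>m\<in>L. s m) = N"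
    using group[of "\<lambda>_. 1"] by (simp add: s_def N_def)
  have "(\<Sum>m\<in>L - G. s m) \<le> (\<Sum>m\<in>L - G. 3 * N / (4 * 2 ^ t))"
    by (rule sum_mono) (auto simp: G_def field_simps)
  also have "\<dots> \<le> (\<Sum>m\<in>L. 3 * N / (4 * 2 ^ t))"
    using finL N by (intro sum_mono2) auto
  also have "\<dots> = 3 / 4 * N" by (simp add: cardL)
  finally have "(\<Sum>m\<in>L - G. s m) \<le> 3 / 4 * N" .
  moreover have "(\<Sum>m\<in>L. s m) = (\<Sum>m\<in>L - G. s m) + (\<Sum>m\<in>G. s m)"
    using finL by (intro sum.subset_diff) (auto simp: G_def)
  ultimately have G: "(\<Sum>m\<in>G. s m) \<ge> N / 4" using sum_s by simp
  have small: "(\<Sum>y\<in>F2 n. \<bar>\<Sum>x\<in>S m. f (x + y)\<bar>) \<le> N * s m" for m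
  proof -
    have "\<bar>\<Sum>x\<in>S m. f (x + y)\<bar> \<le> s m" if y: "y \<in> F2 n" for y
    proof -
      have "\<bar>f (x + y)\<bar> \<le> 1" if "x \<in> S m" for x
      proof -
        have "x + y \<in> F2 n" using that y SF[of m] by (intro add_carrier_vec) auto
        then show ?thesis using f by (force simp: Pi_iff)
      qed
      then have "(\<Sum>x\<in>S m. \<bar>f (x + y)\<bar>) \<le> (\<Sum>x\<in>S m. 1)" by (intro sum_mono)
      then have "(\<Sum>x\<in>S m. \<bar>f (x + y)\<bar>) \<le> s m" by (simp add: s_def)
      with sum_abs show ?thesis by (rule order_trans)
    qed
    then have "(\<Sum>y\<in>F2 n. \<bar>\<Sum>x\<in>S m. f (x + y)\<bar>) \<le> (\<Sum>y\<in>F2 n. s m)" by (intro sum_mono)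
    then show ?thesis by (simp add: N_def)
  qed
  have "(\<Sum>(x, y)\<in>F2 n \<times> F2 n. h (M x, y) * f (x + y))
      = (\<Sum>x\<in>F2 n. \<Sum>y\<in>F2 n. h (M x, y) * f (x + y))"
    by (simp add: sum.cartesian_product)
  also have "\<dots> = (\<Sum>m\<in>L. \<Sum>x\<in>S m. \<Sum>y\<in>F2 n. h (M x, y) * f (x + y))"
    by (simp add: group)
  also have "\<dots> = (\<Sum>m\<in>L. \<Sum>y\<in>F2 n. h (m, y) * (\<Sum>x\<in>S m. f (x + y)))"
  proof (rule sum.cong[OF refl])
    fix m
    show "(\<Sum>x\<in>S m. \<Sum>y\<in>F2 n. h (M x, y) * f (x + y))
        = (\<Sum>y\<in>F2 n. h (m, y) * (\<Sum>x\<in>S m. f (x + y)))"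
      unfolding sum_distrib_left by (subst sum.swap) (simp add: S_def)
  qed
  also have "\<dots> \<le> (\<Sum>m\<in>L. \<Sum>y\<in>F2 n. \<bar>\<Sum>x\<in>S m. f (x + y)\<bar>)"
  proof (intro sum_mono)
    fix m and y :: bvec assume "m \<in> L" "y \<in> F2 n"
    then have "h (m, y) \<in> {1, -1}" using h by (auto simp: L_def Pi_iff)
    then show "h (m, y) * (\<Sum>x\<in>S m. f (x + y)) \<le> \<bar>\<Sum>x\<in>S m. f (x + y)\<bar>" by auto
  qed
  also have "\<dots> \<le> (\<Sum>m\<in>L. N * s m - (if m \<in> G then N * s m / (6 * real n) else 0))"
  proof (rule sum_mono)
    fix m assume "m \<in> L"
    show "(\<Sum>y\<in>F2 n. \<bar>\<Sum>x\<in>S m. f (x + y)\<bar>)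
        \<le> N * s m - (if m \<in> G then N * s m / (6 * real n) else 0)"
    proof (cases "m \<in> G")
      case True
      then have "3 * real (card (F2 n)) \<le> 4 * 2 ^ t * real (card (S m))"
        by (simp add: G_def N_def s_def)
      from large_message_correlation[OF f SF t not this] True
      show ?thesis by (simp add: N_def s_def algebra_simps)
    next
      case False
      then show ?thesis using small by simp
    qed
  qed
  also have "\<dots> = N * N - N * (\<Sum>m\<in>G. s m) / (6 * real n)"
  proof -
    have "(\<Sum>m\<in>L. if m \<in> G then N * s m / (6 * real n) else 0)
        = (\<Sum>m\<in>G. N * s m / (6 * real n))"
      using finL by (subst sum.inter_restrict[symmetric]) (auto simp: G_def intro: sum.cong)
    then show ?thesis
      by (simp add: sum_subtractf sum_s sum_divide_distrib flip: sum_distrib_left)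
         (simp add: sum_distrib_left sum_divide_distrib)
  qed
  also have "\<dots> \<le> N * N - N * (N / 4) / (6 * real n)"
    using G N by (intro diff_left_mono divide_right_mono mult_left_mono) auto
  also have "\<dots> = N\<^sup>2 * (1 - 1 / (24 * real n))"
    by (simp add: power2_eq_square algebra_simps)
  finally show ?thesis by (simp add: N_def)
qed

section \<open>From correlation to error probability\<close>

lemma pair_pmf_of_set:
  assumes "finite A" "A \<noteq> {}" "finite B" "B \<noteq> {}"
  shows "pair_pmf (pmf_of_set A) (pmf_of_set B) = pmf_of_set (A \<times> B)"
proof (rule pmf_eqI)
  show "pmf (pair_pmf (pmf_of_set A) (pmf_of_set B)) z = pmf (pmf_of_set (A \<times> B)) z" for z
    using assms by (cases z) (simp add: pmf_pair card_cartesian_product indicator_def)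
qed

theorem theorem1p4:
  "\<exists>c :: real. c > 0 \<and>
     (\<forall>n \<ge> 1. \<forall>f \<in> F2 n \<rightarrow> {1, -1}.
        D_oneway n (c / real n) (xor_fun f) \<ge> D_lin n (1/3) f)"
proof (intro exI[of _ "1/100"] conjI allI impI ballI)
  fix n :: nat and f :: "bvec \<Rightarrow> real"
  assume n: "n \<ge> 1" and f: "f \<in> F2 n \<rightarrow> {1, -1}"
  \<comment> \<open>Error \<delta> means correlation at least 1 - 2\<delta>, so any constant c with
    2c < 1/24 contradicts the correlation bound; 1/100 is such a c.\<close>
  define \<delta> where "\<delta> = 1 / 100 / real n"
  define t where "t = D_oneway n \<delta> (xor_fun f)"
  define N where "N = real (card (F2 n))"
  have N: "N > 0" by (simp add: N_def card_gt_0_iff)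
  have "D_lin n (1/3) f \<le> t"
  proof (rule ccontr)
    assume "\<not> D_lin n (1/3) f \<le> t"
    then have lt: "t < D_lin n (1/3) f" by simp
    \<comment> \<open>The n coordinate forms determine x. This yields t < n, on which the union
      bound over t + 1 characters relies.\<close>
    have "D_lin n (1/3) f \<le> n"
      unfolding D_lin_def by (rule Least_le) (simp add: lin_approx_dim f)
    then have tn: "t < n" using lt by simp
    \<comment> \<open>All d up to t are excluded at once, because the span covering the biased
      characters may have fewer than t generators.\<close>
    have not: "\<not> lin_approx n (1/3) f d" if "d \<le> t" for d
      using that lt unfolding D_lin_def by (intro not_less_Least) simp
    have "oneway_protocol n \<delta> (xor_fun f) t"
      unfolding t_def D_oneway_def
      by (rule LeastI[OF oneway_protocol_dim]) (use f xor_fun_Pi in \<open>auto simp: \<delta>_def\<close>)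
    then obtain M h where M: "M \<in> F2 n \<rightarrow> {m :: bool list. length m = t}"
      and h: "h \<in> {m :: bool list. length m = t} \<times> F2 n \<rightarrow> {1, -1}"
      and pr: "measure_pmf.prob (pair_pmf (pmf_of_set (F2 n)) (pmf_of_set (F2 n)))
          {(x, y). h (M x, y) = xor_fun f (x, y)} \<ge> 1 - \<delta>"
      by (auto simp: oneway_protocol_def)
    define E where "E = {z \<in> F2 n \<times> F2 n. h (M (fst z), snd z) = f (fst z + snd z)}"
    have "pair_pmf (pmf_of_set (F2 n)) (pmf_of_set (F2 n)) = pmf_of_set (F2 n \<times> F2 n)"
      by (rule pair_pmf_of_set) simp_all
    moreover have "(F2 n \<times> F2 n) \<inter> {(x, y). h (M x, y) = xor_fun f (x, y)} = E"
      by (auto simp: E_def xor_fun_def)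
    ultimately have "real (card E) / (N * N) \<ge> 1 - \<delta>"
      using pr by (simp add: measure_pmf_of_set N_def card_cartesian_product)
    then have E: "real (card E) \<ge> (1 - \<delta>) * N\<^sup>2"
      using N by (simp add: field_simps power2_eq_square)
    have "(\<Sum>(x, y)\<in>F2 n \<times> F2 n. h (M x, y) * f (x + y))
        = 2 * real (card E) - real (card (F2 n \<times> F2 n))"
      unfolding E_def case_prod_beta
    proof (rule sum_mult_sign_eq_card)
      fix z assume z: "z \<in> F2 n \<times> F2 n"
      show "h (M (fst z), snd z) \<in> {1, -1}" by (rule Pi_mem[OF h]) (use z M in auto)
      show "f (fst z + snd z) \<in> {1, -1}" by (rule Pi_mem[OF f]) (use z in auto)
    qed simp
    also have "\<dots> \<ge> (1 - 2 * \<delta>) * N\<^sup>2"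
      using E by (simp add: card_cartesian_product N_def power2_eq_square algebra_simps)
    also note protocol_correlation[OF f tn not M h, folded N_def]
    finally have "(1 - 2 * \<delta>) * N\<^sup>2 \<le> N\<^sup>2 * (1 - 1 / (24 * real n))" by simp
    then have "1 - 2 * \<delta> \<le> 1 - 1 / (24 * real n)"
      using N by (simp add: mult.commute[of _ "N\<^sup>2"])
    then show False using n by (simp add: \<delta>_def field_simps)
  qed
  then show "D_lin n (1/3) f \<le> D_oneway n (1 / 100 / real n) (xor_fun f)"
    by (simp add: t_def \<delta>_def)
qed simp

end
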